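(* Let $\mathbb{X}$ be a classical restriction category with binary products (denoted $\&$) and binary restriction products (denoted $\times$). Then for all objects $A$ and $B$, the product $A\& B$ is a restriction coproduct of $A$, $B$ and $A\times B$ with injection maps $\iota_0:A\to A\& B$, $\iota_1:B\to A\& B$, $\iota_2:A\times B\to A\& B$ given by $$\iota_0=\langle\!\langle 1_A,0\rangle\!\rangle,\qquad \iota_1=\langle\!\langle 0,1_B\rangle\!\rangle,\qquad \iota_2=\langle\!\langle\pi_0,\pi_1\rangle\!\rangle .$$ Furthermore, for maps $f:A\to C$, $g:B\to C$ and $h:A\times B\to C$, their copairing $[f,g,h]:A\& B\to C$ is $$[f,g,h]=\overline{p_1}^{\,c}p_0f\ \vee\ \overline{p_0}^{\,c}p_1g\ \vee\ \langle p_0,p_1\rangle h .$$ Moreover, $p_0=[1_A,0,\pi_0]$ and $p_1=[0,1_B,\pi_1]$.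
   Context: Composition is written in diagrammatic order: for $f:A\to B$ and $g:B\to C$, $fg:A\to C$ is first $f$, then $g$. **Restriction categories.** A restriction category is a category $\mathbb{X}$ with an operator assigning to each map $f:A\to B$ a map $\overline{f}:A\to A$ such that (whenever the expressions are well-typed) [R.1] $\overline{f}f=f$; [R.2] $\overline{f}\,\overline{g}=\overline{g}\,\overline{f}$; [R.3] $\overline{\overline{g}f}=\overline{g}\,\overline{f}$; [R.4] $f\overline{g}=\overline{fg}f$. A map $f:A\to B$ is total if $\overline{f}=1_A$; a restriction idempotent is a map $e:A\to A$ with $\overline{e}=e$. $\mathbb{X}$ has restriction zeroes if it has zero maps $0:A\to B$ for all $A,B$ (so $f0=0=0f$ for all $f$) and $\overline{0}=0$. **Classical restriction categories.** For parallel $f,g:A\to B$ in a restriction category: $f\le g$ means $\overline{f}g=f$; $f\smile g$ (compatible) means $\overline{f}g=\overline{g}f$; if there are restriction zeroes, $f\perp g$ (disjoint) means $\overline{f}g=0$. The join of a finite family of pairwise compatible parallel maps $f_0,\dots,f_n:A\to B$ is their least upper bound $f_0\vee\dots\vee f_n$ with respect to $\le$. A join restriction category is a restriction category in which every finite (possibly empty) pairwise compatible family of parallel maps has a join and joins are preserved by precomposition: $h(f_0\vee\dots\vee f_n)=hf_0\vee\dots\vee hf_n$. (Such a category has restriction zeroes, given by empty joins.) A classical restriction category is a join restriction category in which for all parallel $f\le g$ there is a (necessarily unique) map $g\backslash f$ (the relative complement) with $g\backslash f\perp f$ and $g\backslash f\vee f=g$. For a restriction idempotent $e:A\to A$ (which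 satisfies $e\le 1_A$), its complement is $e^c:=1_A\backslash e$. **Products, restriction products, restriction coproducts.** Binary products are genuine categorical products, written $A\& B$ with projections $p_0:A\& B\to A$, $p_1:A\& B\to B$ (not assumed total) and pairing $\langle\!\langle f,g\rangle\!\rangle$. A restriction product of $A,B$ is an object $A\times B$ with total maps $\pi_0:A\times B\to A$, $\pi_1:A\times B\to B$ such that for all $f:C\to A$, $g:C\to B$ there is a unique $\langle f,g\rangle:C\to A\times B$ with $\langle f,g\rangle\pi_0=\overline{g}f$ and $\langle f,g\rangle\pi_1=\overline{f}g$. A restriction coproduct is a categorical coproduct whose injections are total. *)

theory Defs
  imports Main
begin

section \<open>Restriction categories\<close>

text \<open>
  The composition \<open>f \<cdot> g\<close> is in diagrammatic order (first \<open>f\<close>, then \<open>g\<close>), and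
  \<open>Rst X f\<close> is the restriction of \<open>f\<close>, written with an overline on paper.  All fields are total
  HOL functions; only their values on objects and on well-typed composites are constrained.
\<close>

record ('o, 'a) rcat =
  Obj :: "'o set"
  Arr :: "'a set"
  Dom :: "'a \<Rightarrow> 'o"
  Cod :: "'a \<Rightarrow> 'o"
  Id  :: "'o \<Rightarrow> 'a"
  Cmp :: "'a \<Rightarrow> 'a \<Rightarrow> 'a"  (infixl "\<cdot>\<index>" 70)
  Rst :: "'a \<Rightarrow> 'a"

definition hom :: "('o, 'a, 'm) rcat_scheme \<Rightarrow> 'o \<Rightarrow> 'o \<Rightarrow> 'a set" where
  "hom X A B = {f \<in> Arr X. Dom X f = A \<and> Cod X f = B}"

locale category =
  fixes X :: "('o, 'a, 'm) rcat_scheme" (structure)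
  assumes Dom_Obj: "f \<in> Arr X \<Longrightarrow> Dom X f \<in> Obj X"
    and Cod_Obj: "f \<in> Arr X \<Longrightarrow> Cod X f \<in> Obj X"
    and Id_hom: "A \<in> Obj X \<Longrightarrow> Id X A \<in> hom X A A"
    and Cmp_hom: "\<lbrakk>f \<in> hom X A B; g \<in> hom X B C\<rbrakk> \<Longrightarrow> f \<cdot> g \<in> hom X A C"
    and Id_Cmp: "f \<in> hom X A B \<Longrightarrow> Id X A \<cdot> f = f"
    and Cmp_Id: "f \<in> hom X A B \<Longrightarrow> f \<cdot> Id X B = f"
    and Cmp_assoc:
      "\<lbrakk>f \<in> hom X A B; g \<in> hom X B C; h \<in> hom X C D\<rbrakk> \<Longrightarrow> (f \<cdot> g) \<cdot> h = f \<cdot> (g \<cdot> h)"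

locale restriction_category = category +
  assumes Rst_hom: "f \<in> hom X A B \<Longrightarrow> Rst X f \<in> hom X A A"
    and R1: "f \<in> hom X A B \<Longrightarrow> Rst X f \<cdot> f = f"
    and R2: "\<lbrakk>f \<in> hom X A B; g \<in> hom X A C\<rbrakk> \<Longrightarrow> Rst X f \<cdot> Rst X g = Rst X g \<cdot> Rst X f"
    and R3: "\<lbrakk>f \<in> hom X A B; g \<in> hom X A C\<rbrakk> \<Longrightarrow> Rst X (Rst X g \<cdot> f) = Rst X g \<cdot> Rst X f"
    and R4: "\<lbrakk>f \<in> hom X A B; g \<in> hom X B C\<rbrakk> \<Longrightarrow> f \<cdot> Rst X g = Rst X (f \<cdot> g) \<cdot> f"

definition total :: "('o, 'a, 'm) rcat_scheme \<Rightarrow> 'a \<Rightarrow> bool" where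
  "total X f \<longleftrightarrow> Rst X f = Id X (Dom X f)"

definition restriction_zeroes :: "('o, 'a, 'm) rcat_scheme \<Rightarrow> ('o \<Rightarrow> 'o \<Rightarrow> 'a) \<Rightarrow> bool" where
  "restriction_zeroes X Z \<longleftrightarrow>
     (\<forall>A\<in>Obj X. \<forall>B\<in>Obj X. Z A B \<in> hom X A B \<and> Rst X (Z A B) = Z A A) \<and>
     (\<forall>A\<in>Obj X. \<forall>B\<in>Obj X. \<forall>C\<in>Obj X.
        (\<forall>f\<in>hom X A B. Cmp X f (Z B C) = Z A C) \<and>
        (\<forall>f\<in>hom X B C. Cmp X (Z A B) f = Z A C))"

text \<open>
  On objects a family of zero maps is unique: for two families \<open>Z\<close>, \<open>Z'\<close> one has
  \<open>Z A B = Z A A \<cdot> Z' A B = Z' A B\<close>.  Hence the description below is proper as soon as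
  restriction zeroes exist.
\<close>

definition zero :: "('o, 'a, 'm) rcat_scheme \<Rightarrow> 'o \<Rightarrow> 'o \<Rightarrow> 'a" where
  "zero X A B = (THE z. \<exists>Z. restriction_zeroes X Z \<and> z = Z A B)"


section \<open>Join and classical restriction categories\<close>

text \<open>The next three relations are only meant for parallel maps.\<close>

definition leq :: "('o, 'a, 'm) rcat_scheme \<Rightarrow> 'a \<Rightarrow> 'a \<Rightarrow> bool" where
  "leq X f g \<longleftrightarrow> Cmp X (Rst X f) g = f"

definition compatible :: "('o, 'a, 'm) rcat_scheme \<Rightarrow> 'a \<Rightarrow> 'a \<Rightarrow> bool" where
  "compatible X f g \<longleftrightarrow> Cmp X (Rst X f) g = Cmp X (Rst X g) f"

definition disjoint :: "('o, 'a, 'm) rcat_scheme \<Rightarrow> 'a \<Rightarrow> 'a \<Rightarrow> bool" where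
  "disjoint X f g \<longleftrightarrow> Cmp X (Rst X f) g = zero X (Dom X f) (Cod X g)"

text \<open>
  Finite families are represented by the finite sets of their members, which may be empty; this
  is why the hom-set has to be given explicitly.
\<close>

definition compatible_family ::
  "('o, 'a, 'm) rcat_scheme \<Rightarrow> 'o \<Rightarrow> 'o \<Rightarrow> 'a set \<Rightarrow> bool" where
  "compatible_family X A B S \<longleftrightarrow>
     finite S \<and> S \<subseteq> hom X A B \<and> (\<forall>f\<in>S. \<forall>g\<in>S. compatible X f g)"

definition is_join :: "('o, 'a, 'm) rcat_scheme \<Rightarrow> 'o \<Rightarrow> 'o \<Rightarrow> 'a set \<Rightarrow> 'a \<Rightarrow> bool" where
  "is_join X A B S j \<longleftrightarrow>
     compatible_family X A B S \<and> j \<in> hom X A B \<and> (\<forall>f\<in>S. leq X f j) \<and>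
     (\<forall>k\<in>hom X A B. (\<forall>f\<in>S. leq X f k) \<longrightarrow> leq X j k)"

definition join :: "('o, 'a, 'm) rcat_scheme \<Rightarrow> 'o \<Rightarrow> 'o \<Rightarrow> 'a set \<Rightarrow> 'a" where
  "join X A B S = (THE j. is_join X A B S j)"

locale join_restriction_category = restriction_category +
  assumes join_ex:
      "\<lbrakk>A \<in> Obj X; B \<in> Obj X; compatible_family X A B S\<rbrakk> \<Longrightarrow> \<exists>j. is_join X A B S j"
    and join_precomp:
      "\<lbrakk>h \<in> hom X D A; is_join X A B S j\<rbrakk> \<Longrightarrow> is_join X D B ((\<lambda>f. h \<cdot> f) ` S) (h \<cdot> j)"

definition is_relative_complement ::
  "('o, 'a, 'm) rcat_scheme \<Rightarrow> 'a \<Rightarrow> 'a \<Rightarrow> 'a \<Rightarrow> bool" where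
  "is_relative_complement X g f d \<longleftrightarrow>
     disjoint X d f \<and> is_join X (Dom X g) (Cod X g) {d, f} g"

definition relative_complement :: "('o, 'a, 'm) rcat_scheme \<Rightarrow> 'a \<Rightarrow> 'a \<Rightarrow> 'a" where
  "relative_complement X g f = (THE d. is_relative_complement X g f d)"

definition idem_compl :: "('o, 'a, 'm) rcat_scheme \<Rightarrow> 'a \<Rightarrow> 'a" where
  "idem_compl X e = relative_complement X (Id X (Dom X e)) e"

locale classical_restriction_category = join_restriction_category +
  assumes relative_complement_ex:
    "\<lbrakk>f \<in> hom X A B; g \<in> hom X A B; leq X f g\<rbrakk> \<Longrightarrow> \<exists>d. is_relative_complement X g f d"


section \<open>Products, restriction products, restriction coproducts\<close>

definition is_product ::
  "('o, 'a, 'm) rcat_scheme \<Rightarrow> 'o \<Rightarrow> 'o \<Rightarrow> 'o \<Rightarrow> 'a \<Rightarrow> 'a \<Rightarrow> bool" where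
  "is_product X A B P p0 p1 \<longleftrightarrow>
     P \<in> Obj X \<and> p0 \<in> hom X P A \<and> p1 \<in> hom X P B \<and>
     (\<forall>C\<in>Obj X. \<forall>f\<in>hom X C A. \<forall>g\<in>hom X C B.
        \<exists>!u. u \<in> hom X C P \<and> Cmp X u p0 = f \<and> Cmp X u p1 = g)"

definition pairing ::
  "('o, 'a, 'm) rcat_scheme \<Rightarrow> 'o \<Rightarrow> 'a \<Rightarrow> 'a \<Rightarrow> 'a \<Rightarrow> 'a \<Rightarrow> 'a" where
  "pairing X P p0 p1 f g =
     (THE u. u \<in> hom X (Dom X f) P \<and> Cmp X u p0 = f \<and> Cmp X u p1 = g)"

definition is_restriction_product ::
  "('o, 'a, 'm) rcat_scheme \<Rightarrow> 'o \<Rightarrow> 'o \<Rightarrow> 'o \<Rightarrow> 'a \<Rightarrow> 'a \<Rightarrow> bool" where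
  "is_restriction_product X A B R \<pi>0 \<pi>1 \<longleftrightarrow>
     R \<in> Obj X \<and> \<pi>0 \<in> hom X R A \<and> \<pi>1 \<in> hom X R B \<and> total X \<pi>0 \<and> total X \<pi>1 \<and>
     (\<forall>C\<in>Obj X. \<forall>f\<in>hom X C A. \<forall>g\<in>hom X C B.
        \<exists>!u. u \<in> hom X C R \<and> Cmp X u \<pi>0 = Cmp X (Rst X g) f \<and> Cmp X u \<pi>1 = Cmp X (Rst X f) g)"

definition restriction_pairing ::
  "('o, 'a, 'm) rcat_scheme \<Rightarrow> 'o \<Rightarrow> 'a \<Rightarrow> 'a \<Rightarrow> 'a \<Rightarrow> 'a \<Rightarrow> 'a" where
  "restriction_pairing X R \<pi>0 \<pi>1 f g =
     (THE u. u \<in> hom X (Dom X f) R \<and>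
        Cmp X u \<pi>0 = Cmp X (Rst X g) f \<and> Cmp X u \<pi>1 = Cmp X (Rst X f) g)"

definition has_binary_products :: "('o, 'a, 'm) rcat_scheme \<Rightarrow> bool" where
  "has_binary_products X \<longleftrightarrow>
     (\<forall>A\<in>Obj X. \<forall>B\<in>Obj X. \<exists>P p0 p1. is_product X A B P p0 p1)"

definition has_binary_restriction_products :: "('o, 'a, 'm) rcat_scheme \<Rightarrow> bool" where
  "has_binary_restriction_products X \<longleftrightarrow>
     (\<forall>A\<in>Obj X. \<forall>B\<in>Obj X. \<exists>R \<pi>0 \<pi>1. is_restriction_product X A B R \<pi>0 \<pi>1)"

definition is_coproduct3 ::
  "('o, 'a, 'm) rcat_scheme \<Rightarrow> 'o \<Rightarrow> 'o \<Rightarrow> 'o \<Rightarrow> 'o \<Rightarrow> 'a \<Rightarrow> 'a \<Rightarrow> 'a \<Rightarrow> bool" where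
  "is_coproduct3 X A0 A1 A2 Q i0 i1 i2 \<longleftrightarrow>
     Q \<in> Obj X \<and> i0 \<in> hom X A0 Q \<and> i1 \<in> hom X A1 Q \<and> i2 \<in> hom X A2 Q \<and>
     (\<forall>C\<in>Obj X. \<forall>f\<in>hom X A0 C. \<forall>g\<in>hom X A1 C. \<forall>h\<in>hom X A2 C.
        \<exists>!u. u \<in> hom X Q C \<and> Cmp X i0 u = f \<and> Cmp X i1 u = g \<and> Cmp X i2 u = h)"

definition is_restriction_coproduct3 ::
  "('o, 'a, 'm) rcat_scheme \<Rightarrow> 'o \<Rightarrow> 'o \<Rightarrow> 'o \<Rightarrow> 'o \<Rightarrow> 'a \<Rightarrow> 'a \<Rightarrow> 'a \<Rightarrow> bool" where
  "is_restriction_coproduct3 X A0 A1 A2 Q i0 i1 i2 \<longleftrightarrow>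
     is_coproduct3 X A0 A1 A2 Q i0 i1 i2 \<and> total X i0 \<and> total X i1 \<and> total X i2"

definition copairing3 ::
  "('o, 'a, 'm) rcat_scheme \<Rightarrow> 'o \<Rightarrow> 'a \<Rightarrow> 'a \<Rightarrow> 'a \<Rightarrow> 'a \<Rightarrow> 'a \<Rightarrow> 'a \<Rightarrow> 'a" where
  "copairing3 X Q i0 i1 i2 f g h =
     (THE u. u \<in> hom X Q (Cod X f) \<and>
        Cmp X i0 u = f \<and> Cmp X i1 u = g \<and> Cmp X i2 u = h)"

end

theory Submission
  imports Defs
begin

text \<open>
  A map into the product \<open>P\<close> of \<open>A\<close> and \<open>B\<close> is an arbitrary pair of partial maps, so at every point
  of \<open>P\<close> either only the first component is defined, or only the second, or both (a point at which
  neither is defined does not occur in \<open>P\<close>).  Accordingly \<open>P\<close> should split into \<open>A\<close>, \<open>B\<close> and \<open>A \<times> B\<close>.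

  On paper write \<open>e\<^sub>i\<close> for the domain of \<open>p\<^sub>i\<close> and \<open>c\<^sub>i\<close> for its complement.  The three parts are the
  restriction idempotents \<open>c\<^sub>1\<close>, \<open>c\<^sub>0\<close> and \<open>e\<^sub>0e\<^sub>1\<close> on \<open>P\<close>.  They are pairwise disjoint and their join is
  the identity (\<open>pieces_disjoint\<close>, \<open>pieces_cover\<close>): both facts come from the uniqueness part of the
  universal property of \<open>P\<close>, because \<open>c\<^sub>1c\<^sub>0\<close> has the same two components as \<open>0\<close>, and the join of the
  three has the same two components as the identity.  The same principle shows that each part
  factors through its injection (\<open>pieces_factor\<close>):
  \<open>c\<^sub>1 = c\<^sub>1p\<^sub>0\<iota>\<^sub>0\<close>, \<open>c\<^sub>0 = c\<^sub>0p\<^sub>1\<iota>\<^sub>1\<close> and \<open>e\<^sub>0e\<^sub>1 = \<langle>p\<^sub>0, p\<^sub>1\<rangle>\<iota>\<^sub>2\<close>.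

  Uniqueness of the copairing and the formula for it follow at once.  If \<open>\<iota>\<^sub>0u = f\<close>, \<open>\<iota>\<^sub>1u = g\<close> and
  \<open>\<iota>\<^sub>2u = h\<close>, then \<open>u\<close> is the join of its restrictions to the three parts
  (\<open>is_join_restrictions\<close>), and by the factorisations these restrictions are \<open>c\<^sub>1p\<^sub>0f\<close>, \<open>c\<^sub>0p\<^sub>1g\<close>
  and \<open>\<langle>p\<^sub>0, p\<^sub>1\<rangle>h\<close>.  Conversely these three maps have disjoint domains, so they have a join; since
  joins are preserved by precomposition and each injection meets one part only
  (\<open>i0_pieces\<close>, \<open>i1_pieces\<close>, \<open>i2_pieces\<close>), that join has the required composites with the injections.
\<close>

section \<open>Restriction idempotents and the restriction order\<close>

context category
begin

lemma hom_Obj: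
  assumes "f \<in> hom X A B"
  shows "A \<in> Obj X" and "B \<in> Obj X"
  using assms Dom_Obj Cod_Obj by (auto simp: hom_def)

end

context restriction_category
begin

text \<open>The restriction idempotents on \<open>A\<close>, that is, the possible domains of maps out of \<open>A\<close>.\<close>

definition rid where
  "rid A = {e \<in> hom X A A. Rst X e = e}"

lemma rid_hom: "e \<in> rid A \<Longrightarrow> e \<in> hom X A A"
  and Rst_rid: "e \<in> rid A \<Longrightarrow> Rst X e = e"
  by (simp_all add: rid_def)

lemma Rst_Id:
  assumes "A \<in> Obj X" shows "Rst X (Id X A) = Id X A"
  using R1[OF Id_hom[OF assms]] Cmp_Id[OF Rst_hom[OF Id_hom[OF assms]]] by simp

lemma Rst_in_rid:
  assumes f: "f \<in> hom X A B" shows "Rst X f \<in> rid A"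
proof -
  have A: "A \<in> Obj X" using hom_Obj[OF f] by simp
  have "Rst X (Rst X f) = Rst X f"
    using R3[OF Id_hom[OF A] f] Cmp_Id[OF Rst_hom[OF f]] Rst_Id[OF A] by simp
  then show ?thesis using Rst_hom[OF f] by (simp add: rid_def)
qed

lemma rid_commute: "\<lbrakk>d \<in> rid A; e \<in> rid A\<rbrakk> \<Longrightarrow> d \<cdot> e = e \<cdot> d"
  using R2 by (metis Rst_rid rid_hom)

lemma Rst_rid_Cmp: "\<lbrakk>e \<in> rid A; f \<in> hom X A B\<rbrakk> \<Longrightarrow> Rst X (e \<cdot> f) = e \<cdot> Rst X f"
  using R3 by (metis Rst_rid rid_hom)

lemma rid_Cmp: "\<lbrakk>d \<in> rid A; e \<in> rid A\<rbrakk> \<Longrightarrow> d \<cdot> e \<in> rid A"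
  using Rst_rid_Cmp[of d A e A] Cmp_hom[of d A A e A] by (simp add: rid_def)

lemma Rst_absorb:
  assumes f: "f \<in> hom X A B" and g: "g \<in> hom X B C"
  shows "Rst X f \<cdot> Rst X (f \<cdot> g) = Rst X (f \<cdot> g)"
  using R3[OF Cmp_hom[OF f g] f] R1[OF f] Cmp_assoc[OF Rst_hom[OF f] f g] by simp

lemma total_of_total_Cmp:
  assumes f: "f \<in> hom X A B" and g: "g \<in> hom X B C" and t: "total X (f \<cdot> g)"
  shows "total X f"
proof -
  have D: "Dom X f = A" "Dom X (f \<cdot> g) = A" using f Cmp_hom[OF f g] by (auto simp: hom_def)
  then show ?thesis
    using Rst_absorb[OF f g] t Cmp_Id[OF Rst_hom[OF f]] by (simp add: total_def)
qed

text \<open>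
  Following a map by a total one does not change its domain: \<open>[R.4]\<close> gives
  \<open>f = Rst X (f \<cdot> g) \<cdot> f\<close>, hence one inequality of domains, and \<open>Rst_absorb\<close> is the other one.
\<close>

lemma Rst_Cmp_total:
  assumes f: "f \<in> hom X A B" and g: "g \<in> hom X B C" and t: "total X g"
  shows "Rst X (f \<cdot> g) = Rst X f"
proof -
  have "f = Rst X (f \<cdot> g) \<cdot> f"
    using R4[OF f g] t g Cmp_Id[OF f] by (simp add: total_def hom_def)
  then have "Rst X f = Rst X (f \<cdot> g) \<cdot> Rst X f"
    using R3[OF f Cmp_hom[OF f g]] by simp
  then show ?thesis
    using Rst_absorb[OF f g] R2[OF f Cmp_hom[OF f g]] by simp
qed

lemma Cmp_Rst_of_total:
  assumes f: "f \<in> hom X A B" and g: "g \<in> hom X B C" and t: "total X (f \<cdot> g)"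
  shows "f \<cdot> Rst X g = f"
proof -
  have "Dom X (f \<cdot> g) = A" using Cmp_hom[OF f g] by (simp add: hom_def)
  then show ?thesis using R4[OF f g] t Id_Cmp[OF f] by (simp add: total_def)
qed

lemma leq_antisym:
  assumes f: "f \<in> hom X A B" and g: "g \<in> hom X A B" and fg: "leq X f g" and gf: "leq X g f"
  shows "f = g"
proof -
  have "f = Rst X f \<cdot> (Rst X g \<cdot> f)" using fg gf by (simp add: leq_def)
  also have "\<dots> = Rst X g \<cdot> (Rst X f \<cdot> f)"
    using Cmp_assoc[OF Rst_hom[OF f] Rst_hom[OF g] f] R2[OF f g]
      Cmp_assoc[OF Rst_hom[OF g] Rst_hom[OF f] f] by simp
  also have "\<dots> = g" using R1[OF f] gf by (simp add: leq_def)
  finally show ?thesis .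
qed

lemma leq_trans:
  assumes f: "f \<in> hom X A B" and g: "g \<in> hom X A B" and h: "h \<in> hom X A B"
    and fg: "leq X f g" and gh: "leq X g h"
  shows "leq X f h"
proof -
  have "Rst X f = Rst X f \<cdot> Rst X g" using R3[OF g f] fg by (simp add: leq_def)
  then have "Rst X f \<cdot> h = Rst X f \<cdot> (Rst X g \<cdot> h)"
    using Cmp_assoc[OF Rst_hom[OF f] Rst_hom[OF g] h] by simp
  then show ?thesis using fg gh by (simp add: leq_def)
qed

lemma leq_refl: "f \<in> hom X A B \<Longrightarrow> leq X f f"
  by (simp add: leq_def R1)

lemma rid_Cmp_leq:
  assumes e: "e \<in> rid A" and u: "u \<in> hom X A B"
  shows "leq X (e \<cdot> u) u"
  using Cmp_assoc[OF rid_hom[OF e] Rst_hom[OF u] u] R1[OF u] Rst_rid_Cmp[OF e u]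
  by (simp add: leq_def)

lemma leq_Id_iff: "e \<in> hom X A A \<Longrightarrow> leq X e (Id X A) \<longleftrightarrow> e \<in> rid A"
  using Cmp_Id[OF Rst_hom] by (simp add: leq_def rid_def)

lemma Rst_mono:
  assumes f: "f \<in> hom X A B" and g: "g \<in> hom X A B" and fg: "leq X f g"
  shows "leq X (Rst X f) (Rst X g)"
proof -
  have "Rst X f \<cdot> Rst X g = Rst X f" using R3[OF g f] fg by (simp add: leq_def)
  then show ?thesis using Rst_rid[OF Rst_in_rid[OF f]] by (simp add: leq_def)
qed

end

section \<open>Joins and zero maps\<close>

context join_restriction_category
begin

lemma is_join_hom:
  "is_join X A B S j \<Longrightarrow> j \<in> hom X A B"
  "\<lbrakk>is_join X A B S j; f \<in> S\<rbrakk> \<Longrightarrow> f \<in> hom X A B"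
  by (auto simp: is_join_def compatible_family_def)

lemma is_join_upper: "\<lbrakk>is_join X A B S j; f \<in> S\<rbrakk> \<Longrightarrow> leq X f j"
  by (simp add: is_join_def)

lemma is_join_least:
  "\<lbrakk>is_join X A B S j; k \<in> hom X A B; \<And>f. f \<in> S \<Longrightarrow> leq X f k\<rbrakk> \<Longrightarrow> leq X j k"
  by (simp add: is_join_def)

lemma is_join_unique:
  assumes "is_join X A B S j" and "is_join X A B S k" shows "j = k"
  by (meson assms is_join_def leq_antisym)

lemma join_eq: "is_join X A B S j \<Longrightarrow> join X A B S = j"
  unfolding join_def by (blast intro: is_join_unique)

text \<open>
  A family with a greatest member has that member as its join; this is how joins collapse once
  all members but one have become zero.
\<close>

lemma is_join_eq_greatest:
  assumes j: "is_join X A B S j" and f: "f \<in> S" and le: "\<And>g. g \<in> S \<Longrightarrow> leq X g f"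
  shows "j = f"
proof -
  have "f \<in> hom X A B" using j f by (rule is_join_hom)
  then show ?thesis
    using leq_antisym is_join_hom(1)[OF j] is_join_least[OF j] is_join_upper[OF j f] le by meson
qed

text \<open>
  The zero maps are the joins of the empty families, which are the least maps.  Preservation of
  joins by precomposition yields \<open>f0 = 0\<close> only; the two other laws have to be derived.  The zero
  endomap of \<open>A\<close> lies below the identity and is therefore a restriction idempotent.  By the law
  \<open>f0 = 0\<close> it is the domain of every zero map out of \<open>A\<close>, so leastness says that it restricts
  every map out of \<open>A\<close> to zero; applied to the map \<open>0f\<close>, this gives \<open>0f = 0\<close>.
\<close>

lemma restriction_zeroes_ex: "\<exists>Z. restriction_zeroes X Z"
proof -
  define Z where "Z A B = (SOME j. is_join X A B {} j)" for A B
  have J: "is_join X A B {} (Z A B)" if "A \<in> Obj X" "B \<in> Obj X" for A B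
    unfolding Z_def
    by (rule someI_ex[OF join_ex[OF that]]) (simp add: compatible_family_def)
  have hom: "Z A B \<in> hom X A B" if "A \<in> Obj X" "B \<in> Obj X" for A B
    using is_join_hom(1)[OF J[OF that]] .
  have least: "leq X (Z A B) f" if "f \<in> hom X A B" for A B f
    using is_join_least[OF J[OF hom_Obj[OF that]] that] by simp
  have pre: "f \<cdot> Z B C = Z A C" if f: "f \<in> hom X A B" and C: "C \<in> Obj X" for A B C f
    using join_precomp[OF f J[OF hom_Obj(2)[OF f] C]] J[OF hom_Obj(1)[OF f] C]
    by (simp add: is_join_unique)
  have Zrid: "Z A A \<in> rid A" if A: "A \<in> Obj X" for A
    using leq_Id_iff[OF hom[OF A A]] least[OF Id_hom[OF A]] by simp
  have Rst: "Rst X (Z A B) = Z A A" if A: "A \<in> Obj X" and B: "B \<in> Obj X" for A B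
  proof -
    have "Rst X (Z A B) = Rst X (Z A A \<cdot> Z A B)" using pre[OF hom[OF A A] B] by simp
    also have "\<dots> = Z A A \<cdot> Rst X (Z A B)" by (rule Rst_rid_Cmp[OF Zrid[OF A] hom[OF A B]])
    also have "\<dots> = Rst X (Z A B) \<cdot> Z A A"
      by (rule rid_commute[OF Zrid[OF A] Rst_in_rid[OF hom[OF A B]]])
    also have "\<dots> = Z A A" by (rule pre[OF Rst_hom[OF hom[OF A B]] A])
    finally show ?thesis .
  qed
  have post: "Z A B \<cdot> f = Z A C" if A: "A \<in> Obj X" and f: "f \<in> hom X B C" for A B C f
  proof -
    have B: "B \<in> Obj X" and C: "C \<in> Obj X" using hom_Obj[OF f] by auto
    have "Z A A \<cdot> (Z A B \<cdot> f) = Z A C"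
      using least[OF Cmp_hom[OF hom[OF A B] f]] Rst[OF A C] by (simp add: leq_def)
    moreover have "Z A A \<cdot> (Z A B \<cdot> f) = Z A B \<cdot> f"
      using Cmp_assoc[OF hom[OF A A] hom[OF A B] f] pre[OF hom[OF A A] B] by simp
    ultimately show ?thesis by simp
  qed
  have "restriction_zeroes X Z"
    using hom Rst pre post by (simp add: restriction_zeroes_def)
  then show ?thesis by blast
qed

lemma restriction_zeroes_zero:
  assumes Z: "restriction_zeroes X Z" and A: "A \<in> Obj X" and B: "B \<in> Obj X"
  shows "zero X A B = Z A B"
  unfolding zero_def
proof (rule the_equality)
  show "\<exists>Z'. restriction_zeroes X Z' \<and> Z A B = Z' A B" using Z by blast
next
  fix z assume "\<exists>Z'. restriction_zeroes X Z' \<and> z = Z' A B"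
  then obtain Z' where Z': "restriction_zeroes X Z'" and z: "z = Z' A B" by blast
  have "Z A A \<cdot> Z' A B = Z A B"
    using Z Z' A B unfolding restriction_zeroes_def by blast
  moreover have "Z A A \<cdot> Z' A B = Z' A B"
    using Z Z' A B unfolding restriction_zeroes_def by blast
  ultimately show "z = Z A B" using z by simp
qed

lemma zero_hom: "\<lbrakk>A \<in> Obj X; B \<in> Obj X\<rbrakk> \<Longrightarrow> zero X A B \<in> hom X A B"
  and Rst_zero: "\<lbrakk>A \<in> Obj X; B \<in> Obj X\<rbrakk> \<Longrightarrow> Rst X (zero X A B) = zero X A A"
  using restriction_zeroes_ex restriction_zeroes_zero
  by (metis restriction_zeroes_def)+

lemma Cmp_zero:
  assumes f: "f \<in> hom X A B" and C: "C \<in> Obj X"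
  shows "f \<cdot> zero X B C = zero X A C"
proof -
  obtain Z where Z: "restriction_zeroes X Z" using restriction_zeroes_ex ..
  then show ?thesis
    using restriction_zeroes_zero[OF Z] hom_Obj[OF f] C f by (simp add: restriction_zeroes_def)
qed

lemma zero_Cmp:
  assumes f: "f \<in> hom X B C" and A: "A \<in> Obj X"
  shows "zero X A B \<cdot> f = zero X A C"
proof -
  obtain Z where Z: "restriction_zeroes X Z" using restriction_zeroes_ex ..
  then show ?thesis
    using restriction_zeroes_zero[OF Z] hom_Obj[OF f] A f by (simp add: restriction_zeroes_def)
qed

lemma zero_leq: "f \<in> hom X A B \<Longrightarrow> leq X (zero X A B) f"
  using hom_Obj[of f A B] by (simp add: leq_def Rst_zero zero_Cmp)

lemma Cmp_Rst_of_zero: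
  assumes f: "f \<in> hom X A B" and g: "g \<in> hom X B C" and z: "f \<cdot> g = zero X A C"
  shows "f \<cdot> Rst X g = zero X A B"
  using R4[OF f g] z Rst_zero zero_Cmp[OF f] hom_Obj[OF f] hom_Obj[OF g] by simp

text \<open>
  Restrictions of arbitrary maps to disjoint domains are compatible, since restricting either of
  them to the domain of the other one gives zero.
\<close>

lemma compatible_disjoint_restrictions:
  assumes d: "d \<in> rid A" and e: "e \<in> rid A" and de: "d \<cdot> e = zero X A A"
    and u: "u \<in> hom X A B" and v: "v \<in> hom X A B"
  shows "compatible X (d \<cdot> u) (e \<cdot> v)"
proof -
  have A: "A \<in> Obj X" using hom_Obj[OF u] by simp
  have vanish: "Rst X (d \<cdot> u) \<cdot> (e \<cdot> v) = zero X A B"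
    if d: "d \<in> rid A" and e: "e \<in> rid A" and de: "d \<cdot> e = zero X A A"
      and u: "u \<in> hom X A B" and v: "v \<in> hom X A B" for d e u v
  proof -
    have "Rst X (d \<cdot> u) = Rst X u \<cdot> d"
      using Rst_rid_Cmp[OF d u] rid_commute[OF d Rst_in_rid[OF u]] by simp
    then have "Rst X (d \<cdot> u) \<cdot> e = zero X A A"
      using Cmp_assoc[OF Rst_hom[OF u] rid_hom[OF d] rid_hom[OF e]] de
        Cmp_zero[OF Rst_hom[OF u] A] by simp
    then show ?thesis
      using Cmp_assoc[OF Rst_hom[OF Cmp_hom[OF rid_hom[OF d] u]] rid_hom[OF e] v]
        zero_Cmp[OF v A] by simp
  qed
  show ?thesis
    using vanish[OF d e de u v] vanish[OF e d _ v u] rid_commute[OF d e] de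
    by (simp add: compatible_def)
qed

text \<open>
  Restriction idempotents are always compatible because they commute, and their join is again
  one because the identity is an upper bound.
\<close>

lemma rid_join_ex:
  assumes A: "A \<in> Obj X" and D: "finite D" "D \<subseteq> rid A"
  obtains j where "is_join X A A D j" and "j \<in> rid A"
proof -
  have "compatible X d e" if "d \<in> D" "e \<in> D" for d e
    using that D rid_commute Rst_rid by (metis compatible_def subsetD)
  then have "compatible_family X A A D"
    using D rid_hom by (auto simp: compatible_family_def)
  then obtain j where j: "is_join X A A D j" using join_ex[OF A A] by blast
  have "leq X j (Id X A)"
    using is_join_least[OF j Id_hom[OF A]] leq_Id_iff rid_hom D by blast
  then show ?thesis using that j leq_Id_iff is_join_hom(1)[OF j] by blast
qed

text \<open>
  A map is determined by its restrictions to a cover of its source.  This is an instance of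
  joins being preserved by postcomposition, which is not an axiom: it is obtained from
  preservation under precomposition with the domain of \<open>u\<close>.  The join \<open>j\<close> of the restrictions is
  below \<open>u\<close>, so only the domains have to be compared, and the domain of \<open>u\<close> is the join of the
  domains of the restrictions.
\<close>

lemma is_join_restrictions:
  assumes D: "is_join X A A D (Id X A)" and u: "u \<in> hom X A B"
  shows "is_join X A B ((\<lambda>d. d \<cdot> u) ` D) u"
proof -
  have A: "A \<in> Obj X" and B: "B \<in> Obj X" using hom_Obj[OF u] by auto
  have rid: "d \<in> rid A" if "d \<in> D" for d
    using that is_join_hom(2)[OF D] is_join_upper[OF D] leq_Id_iff by blast
  have homu: "d \<cdot> u \<in> hom X A B" if "d \<in> D" for d
    using Cmp_hom[OF rid_hom[OF rid[OF that]] u] .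
  have below: "leq X (d \<cdot> u) u" if "d \<in> D" for d
    using rid_Cmp_leq[OF rid[OF that] u] .
  have "compatible X (d \<cdot> u) (e \<cdot> u)" if d: "d \<in> D" and e: "e \<in> D" for d e
  proof -
    have "Rst X (d \<cdot> u) \<cdot> (e \<cdot> u) = d \<cdot> (e \<cdot> u)" if d: "d \<in> D" and e: "e \<in> D" for d e
    proof -
      note dr = rid[OF d] and er = rid[OF e]
      have "Rst X (d \<cdot> u) \<cdot> (e \<cdot> u) = d \<cdot> (Rst X u \<cdot> (e \<cdot> u))"
        using Rst_rid_Cmp[OF dr u] Cmp_assoc[OF rid_hom[OF dr] Rst_hom[OF u] homu[OF e]] by simp
      also have "Rst X u \<cdot> (e \<cdot> u) = e \<cdot> (Rst X u \<cdot> u)"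
        using Cmp_assoc[OF Rst_hom[OF u] rid_hom[OF er] u] rid_commute[OF er Rst_in_rid[OF u]]
          Cmp_assoc[OF rid_hom[OF er] Rst_hom[OF u] u] by simp
      finally show ?thesis using R1[OF u] by simp
    qed
    then show ?thesis
      using d e rid_commute[OF rid[OF d] rid[OF e]]
        Cmp_assoc[OF rid_hom[OF rid[OF d]] rid_hom[OF rid[OF e]] u]
        Cmp_assoc[OF rid_hom[OF rid[OF e]] rid_hom[OF rid[OF d]] u]
      by (simp add: compatible_def)
  qed
  then have "compatible_family X A B ((\<lambda>d. d \<cdot> u) ` D)"
    using D homu by (auto simp: compatible_family_def is_join_def)
  then obtain j where j: "is_join X A B ((\<lambda>d. d \<cdot> u) ` D) j" using join_ex[OF A B] by blast
  note jh = is_join_hom(1)[OF j]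
  have ju: "leq X j u" using is_join_least[OF j u] below by auto
  \<comment> \<open>Precomposing the cover with the domain of \<open>u\<close> exhibits that domain as a join.\<close>
  have R: "is_join X A A ((\<lambda>d. Rst X u \<cdot> d) ` D) (Rst X u)"
    using join_precomp[OF Rst_hom[OF u] D] Cmp_Id[OF Rst_hom[OF u]] by simp
  have "leq X (Rst X u) (Rst X j)"
  proof (rule is_join_least[OF R Rst_hom[OF jh]])
    fix f assume "f \<in> (\<lambda>d. Rst X u \<cdot> d) ` D"
    then obtain d where d: "d \<in> D" and f: "f = Rst X u \<cdot> d" by blast
    have "f = Rst X (d \<cdot> u)"
      using f Rst_rid_Cmp[OF rid[OF d] u] rid_commute[OF rid[OF d] Rst_in_rid[OF u]] by simp
    then show "leq X f (Rst X j)"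
      using Rst_mono[OF homu[OF d] jh] is_join_upper[OF j] d by simp
  qed
  then have "Rst X u \<cdot> Rst X j = Rst X u" using Rst_rid[OF Rst_in_rid[OF u]] by (simp add: leq_def)
  then have "Rst X u \<cdot> j = u"
    using ju Cmp_assoc[OF Rst_hom[OF u] Rst_hom[OF jh] u] R1[OF u] by (simp add: leq_def)
  then have "leq X u j" by (simp add: leq_def)
  then have "j = u" using leq_antisym[OF jh u ju] by simp
  then show ?thesis using j by simp
qed

end

section \<open>Complements of restriction idempotents\<close>

context classical_restriction_category
begin

lemma is_idem_compl_rid:
  assumes e: "e \<in> rid A" and d: "is_relative_complement X (Id X A) e d"
  shows "d \<in> rid A" and "d \<cdot> e = zero X A A" and "is_join X A A {d, e} (Id X A)"
proof -
  have A: "A \<in> Obj X" using hom_Obj[OF rid_hom[OF e]] by simp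
  show J: "is_join X A A {d, e} (Id X A)"
    using d Id_hom[OF A] by (simp add: is_relative_complement_def hom_def)
  show dr: "d \<in> rid A"
    using leq_Id_iff[of d A] is_join_hom(2)[OF J, of d] is_join_upper[OF J, of d] by simp
  show "d \<cdot> e = zero X A A"
    using d Rst_rid[OF dr] rid_hom[OF dr] rid_hom[OF e]
    by (simp add: is_relative_complement_def disjoint_def hom_def)
qed

text \<open>
  Complements are unique: precomposing \<open>d' \<or> e = 1\<close> with \<open>d\<close> leaves \<open>d = dd'\<close>, because
  \<open>de = 0\<close>.  The hypotheses are symmetric in \<open>d\<close> and \<open>d'\<close>, so the inequality suffices.
\<close>

lemma is_idem_compl_leq:
  assumes e: "e \<in> rid A"
    and d: "is_relative_complement X (Id X A) e d"
    and d': "is_relative_complement X (Id X A) e d'"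
  shows "leq X d d'"
proof -
  note D = is_idem_compl_rid[OF e d] and D' = is_idem_compl_rid[OF e d']
  have "is_join X A A {d \<cdot> d', zero X A A} d"
    using join_precomp[OF rid_hom[OF D(1)] D'(3)] D(2) Cmp_Id[OF rid_hom[OF D(1)]] by simp
  then have "d = d \<cdot> d'"
    by (rule is_join_eq_greatest)
      (use zero_leq leq_refl Cmp_hom[OF rid_hom[OF D(1)] rid_hom[OF D'(1)]] in auto)
  then show ?thesis using Rst_rid[OF D(1)] by (simp add: leq_def)
qed

lemma idem_compl:
  assumes e: "e \<in> rid A"
  shows idem_compl_rid: "idem_compl X e \<in> rid A"
    and idem_compl_Cmp: "idem_compl X e \<cdot> e = zero X A A"
    and idem_compl_is_join: "is_join X A A {idem_compl X e, e} (Id X A)"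
proof -
  have A: "A \<in> Obj X" using hom_Obj[OF rid_hom[OF e]] by simp
  have "leq X e (Id X A)" using leq_Id_iff[OF rid_hom[OF e]] e by simp
  then obtain d where d: "is_relative_complement X (Id X A) e d"
    using relative_complement_ex[OF rid_hom[OF e] Id_hom[OF A]] by blast
  have uniq: "d' = d" if "is_relative_complement X (Id X A) e d'" for d'
    using leq_antisym[of d' A A d] is_idem_compl_rid(1)[OF e] is_idem_compl_leq[OF e] that d rid_hom
    by blast
  have "Dom X e = A" using rid_hom[OF e] by (simp add: hom_def)
  then have "idem_compl X e = (THE d'. is_relative_complement X (Id X A) e d')"
    by (simp add: idem_compl_def relative_complement_def)
  also have "\<dots> = d"
    by (rule the_equality) (fact d, fact uniq)
  finally have "idem_compl X e = d" .
  then show "idem_compl X e \<in> rid A" "idem_compl X e \<cdot> e = zero X A A"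
      "is_join X A A {idem_compl X e, e} (Id X A)"
    using is_idem_compl_rid[OF e d] by auto
qed

text \<open>
  The next two lemmas compute how a map meets a complement: a map landing inside \<open>e\<close> misses
  the complement of \<open>e\<close>, and a map missing \<open>e\<close> lands inside the complement.
\<close>

lemma Cmp_idem_compl_eq_zero:
  assumes e: "e \<in> rid A" and f: "f \<in> hom X C A" and fe: "f \<cdot> e = f"
  shows "f \<cdot> idem_compl X e = zero X C A"
proof -
  have "f \<cdot> idem_compl X e = f \<cdot> (e \<cdot> idem_compl X e)"
    using fe Cmp_assoc[OF f rid_hom[OF e] rid_hom[OF idem_compl_rid[OF e]]] by simp
  then show ?thesis
    using rid_commute[OF e idem_compl_rid[OF e]] idem_compl_Cmp[OF e]
      Cmp_zero[OF f hom_Obj(2)[OF f]] by simp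
qed

lemma Cmp_idem_compl_eq_self:
  assumes e: "e \<in> rid A" and f: "f \<in> hom X C A" and fe: "f \<cdot> e = zero X C A"
  shows "f \<cdot> idem_compl X e = f"
proof -
  have "is_join X C A {f \<cdot> idem_compl X e, zero X C A} f"
    using join_precomp[OF f idem_compl_is_join[OF e]] fe Cmp_Id[OF f] by simp
  then have "f = f \<cdot> idem_compl X e"
    by (rule is_join_eq_greatest)
      (use zero_leq leq_refl Cmp_hom[OF f rid_hom[OF idem_compl_rid[OF e]]] in auto)
  then show ?thesis by simp
qed

lemma idem_compl_Rst_Cmp:
  assumes f: "f \<in> hom X A B"
  shows "idem_compl X (Rst X f) \<cdot> f = zero X A B"
proof -
  note e = Rst_in_rid[OF f]
  have "idem_compl X (Rst X f) \<cdot> f = (idem_compl X (Rst X f) \<cdot> Rst X f) \<cdot> f"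
    using R1[OF f] Cmp_assoc[OF rid_hom[OF idem_compl_rid[OF e]] Rst_hom[OF f] f] by simp
  then show ?thesis
    using idem_compl_Cmp[OF e] zero_Cmp[OF f hom_Obj(1)[OF f]] by simp
qed

end

section \<open>The product as a coproduct\<close>

lemma pairing_unique:
  assumes "is_product X A B P p0 p1" and "C \<in> Obj X" and "f \<in> hom X C A" and "g \<in> hom X C B"
  shows "\<exists>!u. u \<in> hom X C P \<and> Cmp X u p0 = f \<and> Cmp X u p1 = g"
  using assms by (simp add: is_product_def)

lemma pairing_props:
  assumes "is_product X A B P p0 p1" and "C \<in> Obj X" and f: "f \<in> hom X C A" and "g \<in> hom X C B"
  shows "pairing X P p0 p1 f g \<in> hom X C P"
    and "Cmp X (pairing X P p0 p1 f g) p0 = f"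
    and "Cmp X (pairing X P p0 p1 f g) p1 = g"
proof -
  have "Dom X f = C" using f by (simp add: hom_def)
  then show "pairing X P p0 p1 f g \<in> hom X C P"
    and "Cmp X (pairing X P p0 p1 f g) p0 = f"
    and "Cmp X (pairing X P p0 p1 f g) p1 = g"
    using theI'[OF pairing_unique[OF assms]] by (simp_all add: pairing_def)
qed

lemma restriction_pairing_props:
  assumes R: "is_restriction_product X A B R \<pi>0 \<pi>1" and C: "C \<in> Obj X"
    and f: "f \<in> hom X C A" and g: "g \<in> hom X C B"
  shows "restriction_pairing X R \<pi>0 \<pi>1 f g \<in> hom X C R"
    and "Cmp X (restriction_pairing X R \<pi>0 \<pi>1 f g) \<pi>0 = Cmp X (Rst X g) f"
    and "Cmp X (restriction_pairing X R \<pi>0 \<pi>1 f g) \<pi>1 = Cmp X (Rst X f) g"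
proof -
  have D: "Dom X f = C" using f by (simp add: hom_def)
  have "\<exists>!u. u \<in> hom X C R \<and> Cmp X u \<pi>0 = Cmp X (Rst X g) f \<and> Cmp X u \<pi>1 = Cmp X (Rst X f) g"
    using assms by (simp add: is_restriction_product_def)
  from theI'[OF this] show "restriction_pairing X R \<pi>0 \<pi>1 f g \<in> hom X C R"
    and "Cmp X (restriction_pairing X R \<pi>0 \<pi>1 f g) \<pi>0 = Cmp X (Rst X g) f"
    and "Cmp X (restriction_pairing X R \<pi>0 \<pi>1 f g) \<pi>1 = Cmp X (Rst X f) g"
    using D by (simp_all add: restriction_pairing_def)
qed

locale product_and_restriction_product = classical_restriction_category X
  for X :: "('o, 'a, 'm) rcat_scheme" (structure) +
  fixes A B P R :: 'o and p0 p1 \<pi>0 \<pi>1 :: 'a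
  assumes A: "A \<in> Obj X" and B: "B \<in> Obj X"
    and prod: "is_product X A B P p0 p1"
    and rprod: "is_restriction_product X A B R \<pi>0 \<pi>1"
begin

text \<open>
  The three parts of \<open>P\<close> are \<open>c1\<close> (only the first component is defined), \<open>c0\<close> (only the second)
  and \<open>b\<close> (both); \<open>w\<close> carries the last part to the restriction product.
\<close>

abbreviation (input) "c0 \<equiv> idem_compl X (Rst X p0)"
abbreviation (input) "c1 \<equiv> idem_compl X (Rst X p1)"
abbreviation (input) "b \<equiv> Rst X p0 \<cdot> Rst X p1"
abbreviation (input) "w \<equiv> restriction_pairing X R \<pi>0 \<pi>1 p0 p1"
abbreviation (input) "i0 \<equiv> pairing X P p0 p1 (Id X A) (zero X A B)"
abbreviation (input) "i1 \<equiv> pairing X P p0 p1 (zero X B A) (Id X B)"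
abbreviation (input) "i2 \<equiv> pairing X P p0 p1 \<pi>0 \<pi>1"

lemma P: "P \<in> Obj X" and p0: "p0 \<in> hom X P A" and p1: "p1 \<in> hom X P B"
  using prod by (simp_all add: is_product_def)

lemma R: "R \<in> Obj X" and pi0: "\<pi>0 \<in> hom X R A" and pi1: "\<pi>1 \<in> hom X R B"
  and total_pi0: "total X \<pi>0" and total_pi1: "total X \<pi>1"
  using rprod by (simp_all add: is_restriction_product_def)

lemmas e0 = Rst_in_rid[OF p0] and e1 = Rst_in_rid[OF p1]
lemmas c0_rid = idem_compl_rid[OF e0] and c1_rid = idem_compl_rid[OF e1]
lemmas b_rid = rid_Cmp[OF e0 e1]
lemmas i0 = pairing_props[OF prod A Id_hom[OF A] zero_hom[OF A B]]
lemmas i1 = pairing_props[OF prod B zero_hom[OF B A] Id_hom[OF B]]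
lemmas i2 = pairing_props[OF prod R pi0 pi1]
lemmas w = restriction_pairing_props[OF rprod P p0 p1]

lemma p_jointly_monic:
  assumes u: "u \<in> hom X C P" and v: "v \<in> hom X C P"
    and "u \<cdot> p0 = v \<cdot> p0" and "u \<cdot> p1 = v \<cdot> p1"
  shows "u = v"
  using pairing_unique[OF prod hom_Obj(1)[OF v] Cmp_hom[OF v p0] Cmp_hom[OF v p1]] assms by blast

text \<open>
  Each injection has a total composite with one of the projections, which makes it total.
\<close>

lemma total_injections: "total X i0" "total X i1" "total X i2"
proof -
  have "total X (i0 \<cdot> p0)" "total X (i1 \<cdot> p1)" "total X (i2 \<cdot> p0)"
    using i0 i1 i2 total_pi0 Rst_Id A B Id_hom[OF A] Id_hom[OF B]
    by (simp_all add: total_def hom_def)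
  then show "total X i0" "total X i1" "total X i2"
    using total_of_total_Cmp[OF i0(1) p0] total_of_total_Cmp[OF i1(1) p1]
      total_of_total_Cmp[OF i2(1) p0] by auto
qed

lemma Rst_w: "Rst X w = b"
  using Rst_Cmp_total[OF w(1) pi0 total_pi0] w(2) R3[OF p0 p1] R2[OF p0 p1] by simp

lemma b_w: "b \<cdot> w = w"
  using R1[OF w(1)] Rst_w by simp

text \<open>
  The maps \<open>c1 \<cdot> c0\<close> and \<open>0\<close> agree because both components of the former vanish.  This is where
  the points with no defined component are excluded from \<open>P\<close>.  The other two products vanish
  because each contains an idempotent together with its complement.
\<close>

lemma pieces_disjoint:
  "c1 \<cdot> c0 = zero X P P" "c1 \<cdot> b = zero X P P" "c0 \<cdot> b = zero X P P"
proof -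
  note h0 = rid_hom[OF c0_rid] and h1 = rid_hom[OF c1_rid]
  have a0: "c1 \<cdot> c0 \<cdot> p0 = zero X P A"
    using Cmp_assoc[OF h1 h0 p0] idem_compl_Rst_Cmp[OF p0] Cmp_zero[OF h1 A] by simp
  have "c1 \<cdot> c0 = c0 \<cdot> c1" by (rule rid_commute[OF c1_rid c0_rid])
  then have a1: "c1 \<cdot> c0 \<cdot> p1 = zero X P B"
    using Cmp_assoc[OF h0 h1 p1] idem_compl_Rst_Cmp[OF p1] Cmp_zero[OF h0 B] by simp
  show "c1 \<cdot> c0 = zero X P P"
    by (rule p_jointly_monic[OF Cmp_hom[OF h1 h0] zero_hom[OF P P]])
      (use a0 a1 zero_Cmp[OF p0 P] zero_Cmp[OF p1 P] in auto)
  show "c0 \<cdot> b = zero X P P"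
    using Cmp_assoc[OF h0 rid_hom[OF e0] rid_hom[OF e1]] idem_compl_Cmp[OF e0]
      zero_Cmp[OF rid_hom[OF e1] P] by simp
  show "c1 \<cdot> b = zero X P P"
    using Cmp_assoc[OF h1 rid_hom[OF e1] rid_hom[OF e0]] idem_compl_Cmp[OF e1]
      zero_Cmp[OF rid_hom[OF e0] P] R2[OF p0 p1] by simp
qed

text \<open>
  Let \<open>j\<close> be the join of the three parts.  The domain of \<open>p0\<close> is contained in \<open>j\<close>, since it splits
  along \<open>c1\<close> and the domain of \<open>p1\<close> into a piece below \<open>c1\<close> and the piece \<open>b\<close>; likewise for \<open>p1\<close>.
  Hence \<open>j\<close> and the identity have the same components.
\<close>

lemma pieces_cover: "is_join X P P {c1, c0, b} (Id X P)"
proof -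
  obtain j where j: "is_join X P P {c1, c0, b} j" and jr: "j \<in> rid P"
    by (rule rid_join_ex[OF P, of "{c1, c0, b}"]) (use c0_rid c1_rid b_rid in auto)
  \<comment> \<open>Used with \<open>p\<close> one projection and \<open>e\<close> the domain of the other one.\<close>
  have absorb: "j \<cdot> p = p"
    if p: "p \<in> hom X P C" and e: "e \<in> rid P" and m: "idem_compl X e \<in> {c1, c0, b}"
      and n: "Rst X p \<cdot> e = b" for p C e
  proof -
    note pr = Rst_in_rid[OF p] and er = idem_compl_rid[OF e]
    have J: "is_join X P P {Rst X p \<cdot> idem_compl X e, b} (Rst X p)"
      using join_precomp[OF Rst_hom[OF p] idem_compl_is_join[OF e]] n Cmp_Id[OF Rst_hom[OF p]]
      by simp
    have "leq X (Rst X p \<cdot> idem_compl X e) j"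
      by (rule leq_trans[OF Cmp_hom[OF rid_hom[OF pr] rid_hom[OF er]] rid_hom[OF er] rid_hom[OF jr]
            rid_Cmp_leq[OF pr rid_hom[OF er]] is_join_upper[OF j m]])
    then have "leq X (Rst X p) j"
      using is_join_least[OF J rid_hom[OF jr]] is_join_upper[OF j, of b] by auto
    then have "j \<cdot> Rst X p = Rst X p"
      using rid_commute[OF jr pr] Rst_rid[OF pr] by (simp add: leq_def)
    then show ?thesis
      using Cmp_assoc[OF rid_hom[OF jr] Rst_hom[OF p] p] R1[OF p] by simp
  qed
  have "j \<cdot> p0 = p0" "j \<cdot> p1 = p1"
    by (rule absorb[OF p0 e1]; simp) (rule absorb[OF p1 e0]; simp add: R2[OF p1 p0])
  then have "j = Id X P"
    using p_jointly_monic[OF rid_hom[OF jr] Id_hom[OF P]] Id_Cmp[OF p0] Id_Cmp[OF p1] by simp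
  then show ?thesis using j by simp
qed

text \<open>
  On \<open>c1\<close> the second component vanishes, so a point of this part is recovered from its first
  component by \<open>i0\<close>; similarly for the other parts.  In each case the two sides have the same
  components.
\<close>

lemma pieces_factor: "c1 \<cdot> p0 \<cdot> i0 = c1" "c0 \<cdot> p1 \<cdot> i1 = c0" "w \<cdot> i2 = b"
proof -
  note h0 = rid_hom[OF c0_rid] and h1 = rid_hom[OF c1_rid] and hb = rid_hom[OF b_rid]
  note q0 = Cmp_hom[OF h1 p0] and q1 = Cmp_hom[OF h0 p1]
  show "c1 \<cdot> p0 \<cdot> i0 = c1"
    by (rule p_jointly_monic[OF Cmp_hom[OF q0 i0(1)] h1])
      (use Cmp_assoc[OF q0 i0(1) p0] Cmp_assoc[OF q0 i0(1) p1] i0 Cmp_Id[OF q0] Cmp_zero[OF q0 B]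
        idem_compl_Rst_Cmp[OF p1] in auto)
  show "c0 \<cdot> p1 \<cdot> i1 = c0"
    by (rule p_jointly_monic[OF Cmp_hom[OF q1 i1(1)] h0])
      (use Cmp_assoc[OF q1 i1(1) p0] Cmp_assoc[OF q1 i1(1) p1] i1 Cmp_Id[OF q1] Cmp_zero[OF q1 A]
        idem_compl_Rst_Cmp[OF p0] in auto)
  have b0: "b \<cdot> p0 = Rst X p1 \<cdot> p0"
    using R2[OF p0 p1] Cmp_assoc[OF rid_hom[OF e1] rid_hom[OF e0] p0] R1[OF p0] by simp
  have b1: "b \<cdot> p1 = Rst X p0 \<cdot> p1"
    using Cmp_assoc[OF rid_hom[OF e0] rid_hom[OF e1] p1] R1[OF p1] by simp
  show "w \<cdot> i2 = b"
    by (rule p_jointly_monic[OF Cmp_hom[OF w(1) i2(1)] hb])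
      (use Cmp_assoc[OF w(1) i2(1) p0] Cmp_assoc[OF w(1) i2(1) p1] i2 w b0 b1 in auto)
qed

text \<open>
  The first injection lands inside the domain of \<open>p0\<close> (its first component is total) and misses
  the domain of \<open>p1\<close> (its second component is zero), so it lies in the part \<open>c1\<close> alone.  The two
  lemmas after this one place the other injections in the same way.
\<close>

lemma i0_pieces: "i0 \<cdot> c1 = i0" "i0 \<cdot> c0 = zero X A P" "i0 \<cdot> b = zero X A P"
proof -
  have on: "i0 \<cdot> Rst X p0 = i0"
    using Cmp_Rst_of_total[OF i0(1) p0] i0(2) Rst_Id[OF A] Id_hom[OF A]
    by (simp add: total_def hom_def)
  have off: "i0 \<cdot> Rst X p1 = zero X A P" by (rule Cmp_Rst_of_zero[OF i0(1) p1 i0(3)])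
  show "i0 \<cdot> c1 = i0" by (rule Cmp_idem_compl_eq_self[OF e1 i0(1) off])
  show "i0 \<cdot> c0 = zero X A P" by (rule Cmp_idem_compl_eq_zero[OF e0 i0(1) on])
  show "i0 \<cdot> b = zero X A P"
    using Cmp_assoc[OF i0(1) rid_hom[OF e0] rid_hom[OF e1]] on off by simp
qed

lemma i1_pieces: "i1 \<cdot> c1 = zero X B P" "i1 \<cdot> c0 = i1" "i1 \<cdot> b = zero X B P"
proof -
  have on: "i1 \<cdot> Rst X p1 = i1"
    using Cmp_Rst_of_total[OF i1(1) p1] i1(3) Rst_Id[OF B] Id_hom[OF B]
    by (simp add: total_def hom_def)
  have off: "i1 \<cdot> Rst X p0 = zero X B P" by (rule Cmp_Rst_of_zero[OF i1(1) p0 i1(2)])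
  show "i1 \<cdot> c0 = i1" by (rule Cmp_idem_compl_eq_self[OF e0 i1(1) off])
  show "i1 \<cdot> c1 = zero X B P" by (rule Cmp_idem_compl_eq_zero[OF e1 i1(1) on])
  show "i1 \<cdot> b = zero X B P"
    using Cmp_assoc[OF i1(1) rid_hom[OF e0] rid_hom[OF e1]] off zero_Cmp[OF rid_hom[OF e1] B]
    by simp
qed

lemma i2_pieces: "i2 \<cdot> c1 = zero X R P" "i2 \<cdot> c0 = zero X R P" "i2 \<cdot> w = Id X R"
proof -
  have on0: "i2 \<cdot> Rst X p0 = i2"
    using Cmp_Rst_of_total[OF i2(1) p0] i2(2) total_pi0 by simp
  have on1: "i2 \<cdot> Rst X p1 = i2"
    using Cmp_Rst_of_total[OF i2(1) p1] i2(3) total_pi1 by simp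
  show "i2 \<cdot> c1 = zero X R P" by (rule Cmp_idem_compl_eq_zero[OF e1 i2(1) on1])
  show "i2 \<cdot> c0 = zero X R P" by (rule Cmp_idem_compl_eq_zero[OF e0 i2(1) on0])
  have "i2 \<cdot> w \<cdot> \<pi>0 = \<pi>0"
    using Cmp_assoc[OF i2(1) w(1) pi0] w(2) Cmp_assoc[OF i2(1) rid_hom[OF e1] p0] on1 i2(2) by simp
  moreover have "i2 \<cdot> w \<cdot> \<pi>1 = \<pi>1"
    using Cmp_assoc[OF i2(1) w(1) pi1] w(3) Cmp_assoc[OF i2(1) rid_hom[OF e0] p1] on0 i2(3) by simp
  moreover have "Rst X \<pi>0 = Id X R" "Rst X \<pi>1 = Id X R"
    using total_pi0 total_pi1 pi0 pi1 by (simp_all add: total_def hom_def)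
  moreover have "\<exists>!u. u \<in> hom X R R \<and> u \<cdot> \<pi>0 = Rst X \<pi>1 \<cdot> \<pi>0 \<and> u \<cdot> \<pi>1 = Rst X \<pi>0 \<cdot> \<pi>1"
    using rprod R pi0 pi1 by (simp add: is_restriction_product_def)
  ultimately show "i2 \<cdot> w = Id X R"
    using Cmp_hom[OF i2(1) w(1)] Id_hom[OF R] Id_Cmp[OF pi0] Id_Cmp[OF pi1] by metis
qed

context
  fixes C f g h
  assumes f: "f \<in> hom X A C" and g: "g \<in> hom X B C" and h: "h \<in> hom X R C"
begin

lemma branches_hom:
  "c1 \<cdot> p0 \<cdot> f \<in> hom X P C" "c0 \<cdot> p1 \<cdot> g \<in> hom X P C" "w \<cdot> h \<in> hom X P C"
  using Cmp_hom rid_hom[OF c0_rid] rid_hom[OF c1_rid] p0 p1 w(1) f g h by blast+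

text \<open>
  Each branch of the copairing is a restriction to its part of \<open>P\<close>, which brings it into the form
  required by \<open>compatible_disjoint_restrictions\<close> and by the equations that locate the injections.
\<close>

lemma branches_restrict:
  "c1 \<cdot> p0 \<cdot> f = c1 \<cdot> (p0 \<cdot> f)" "c0 \<cdot> p1 \<cdot> g = c0 \<cdot> (p1 \<cdot> g)" "w \<cdot> h = b \<cdot> (w \<cdot> h)"
  using Cmp_assoc[OF rid_hom[OF c1_rid] p0 f] Cmp_assoc[OF rid_hom[OF c0_rid] p1 g]
    Cmp_assoc[OF rid_hom[OF b_rid] w(1) h] b_w by simp_all

lemma branches_compatible: "compatible_family X P C {c1 \<cdot> p0 \<cdot> f, c0 \<cdot> p1 \<cdot> g, w \<cdot> h}"
proof -
  note x = Cmp_hom[OF p0 f] and y = Cmp_hom[OF p1 g] and z = Cmp_hom[OF w(1) h]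
  have "compatible X (c1 \<cdot> (p0 \<cdot> f)) (c0 \<cdot> (p1 \<cdot> g))"
    "compatible X (c1 \<cdot> (p0 \<cdot> f)) (b \<cdot> (w \<cdot> h))"
    "compatible X (c0 \<cdot> (p1 \<cdot> g)) (b \<cdot> (w \<cdot> h))"
    using compatible_disjoint_restrictions[OF c1_rid c0_rid pieces_disjoint(1) x y]
      compatible_disjoint_restrictions[OF c1_rid b_rid pieces_disjoint(2) x z]
      compatible_disjoint_restrictions[OF c0_rid b_rid pieces_disjoint(3) y z] .
  then show ?thesis
    using branches_hom unfolding branches_restrict[symmetric]
    by (auto simp: compatible_family_def compatible_def)
qed

text \<open>
  By the cover of \<open>P\<close>, \<open>u\<close> is the join of its restrictions to the parts, and each part factors
  through an injection, whose composite with \<open>u\<close> is given.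
\<close>

lemma cotuple_is_join:
  assumes u: "u \<in> hom X P C" and "i0 \<cdot> u = f" and "i1 \<cdot> u = g" and "i2 \<cdot> u = h"
  shows "is_join X P C {c1 \<cdot> p0 \<cdot> f, c0 \<cdot> p1 \<cdot> g, w \<cdot> h} u"
proof -
  have "c1 \<cdot> u = c1 \<cdot> p0 \<cdot> f" "c0 \<cdot> u = c0 \<cdot> p1 \<cdot> g" "b \<cdot> u = w \<cdot> h"
    using pieces_factor assms
      Cmp_assoc[OF Cmp_hom[OF rid_hom[OF c1_rid] p0] i0(1) u]
      Cmp_assoc[OF Cmp_hom[OF rid_hom[OF c0_rid] p1] i1(1) u]
      Cmp_assoc[OF w(1) i2(1) u] by simp_all
  then show ?thesis using is_join_restrictions[OF pieces_cover u] by simp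
qed

text \<open>
  Precomposing the join with an injection turns two of its members into zero and the third into
  the prescribed map.
\<close>

lemma join_is_cotuple:
  assumes j: "is_join X P C {c1 \<cdot> p0 \<cdot> f, c0 \<cdot> p1 \<cdot> g, w \<cdot> h} j"
  shows "i0 \<cdot> j = f" and "i1 \<cdot> j = g" and "i2 \<cdot> j = h"
proof -
  note h0 = rid_hom[OF c0_rid] and h1 = rid_hom[OF c1_rid] and hb = rid_hom[OF b_rid]
  note x = Cmp_hom[OF p0 f] and y = Cmp_hom[OF p1 g] and z = Cmp_hom[OF w(1) h]
  have "i0 \<cdot> (c1 \<cdot> p0 \<cdot> f) = f"
    using branches_restrict(1) Cmp_assoc[OF i0(1) h1 x] i0_pieces(1) Cmp_assoc[OF i0(1) p0 f] i0(2)
      Id_Cmp[OF f] by simp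
  moreover have "i0 \<cdot> (c0 \<cdot> p1 \<cdot> g) = zero X A C"
    using branches_restrict(2) Cmp_assoc[OF i0(1) h0 y] i0_pieces(2) zero_Cmp[OF y A] by simp
  moreover have "i0 \<cdot> (w \<cdot> h) = zero X A C"
    using branches_restrict(3) Cmp_assoc[OF i0(1) hb z] i0_pieces(3) zero_Cmp[OF z A] by simp
  ultimately have "is_join X A C {f, zero X A C} (i0 \<cdot> j)"
    using join_precomp[OF i0(1) j] by simp
  then show "i0 \<cdot> j = f"
    by (rule is_join_eq_greatest) (use zero_leq[OF f] leq_refl[OF f] in auto)
  have "i1 \<cdot> (c1 \<cdot> p0 \<cdot> f) = zero X B C"
    using branches_restrict(1) Cmp_assoc[OF i1(1) h1 x] i1_pieces(1) zero_Cmp[OF x B] by simp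
  moreover have "i1 \<cdot> (c0 \<cdot> p1 \<cdot> g) = g"
    using branches_restrict(2) Cmp_assoc[OF i1(1) h0 y] i1_pieces(2) Cmp_assoc[OF i1(1) p1 g] i1(3)
      Id_Cmp[OF g] by simp
  moreover have "i1 \<cdot> (w \<cdot> h) = zero X B C"
    using branches_restrict(3) Cmp_assoc[OF i1(1) hb z] i1_pieces(3) zero_Cmp[OF z B] by simp
  ultimately have "is_join X B C {zero X B C, g} (i1 \<cdot> j)"
    using join_precomp[OF i1(1) j] by (simp add: insert_commute)
  then show "i1 \<cdot> j = g"
    by (rule is_join_eq_greatest) (use zero_leq[OF g] leq_refl[OF g] in auto)
  have "i2 \<cdot> (c1 \<cdot> p0 \<cdot> f) = zero X R C"
    using branches_restrict(1) Cmp_assoc[OF i2(1) h1 x] i2_pieces(1) zero_Cmp[OF x R] by simp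
  moreover have "i2 \<cdot> (c0 \<cdot> p1 \<cdot> g) = zero X R C"
    using branches_restrict(2) Cmp_assoc[OF i2(1) h0 y] i2_pieces(2) zero_Cmp[OF y R] by simp
  moreover have "i2 \<cdot> (w \<cdot> h) = h"
    using Cmp_assoc[OF i2(1) w(1) h] i2_pieces(3) Id_Cmp[OF h] by simp
  ultimately have "is_join X R C {zero X R C, h} (i2 \<cdot> j)"
    using join_precomp[OF i2(1) j] by simp
  then show "i2 \<cdot> j = h"
    by (rule is_join_eq_greatest) (use zero_leq[OF h] leq_refl[OF h] in auto)
qed

lemma cotuple_unique: "\<exists>!u. u \<in> hom X P C \<and> i0 \<cdot> u = f \<and> i1 \<cdot> u = g \<and> i2 \<cdot> u = h"
proof -
  obtain j where j: "is_join X P C {c1 \<cdot> p0 \<cdot> f, c0 \<cdot> p1 \<cdot> g, w \<cdot> h} j"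
    using join_ex[OF P hom_Obj(2)[OF f] branches_compatible] by blast
  show ?thesis
  proof (rule ex1I[of _ j])
    show "j \<in> hom X P C \<and> i0 \<cdot> j = f \<and> i1 \<cdot> j = g \<and> i2 \<cdot> j = h"
      using is_join_hom(1)[OF j] join_is_cotuple[OF j] by simp
    show "u = j" if "u \<in> hom X P C \<and> i0 \<cdot> u = f \<and> i1 \<cdot> u = g \<and> i2 \<cdot> u = h" for u
      using that by (intro is_join_unique[OF cotuple_is_join j]) simp_all
  qed
qed

lemma copairing3_eqI:
  assumes "u \<in> hom X P C" and "i0 \<cdot> u = f" and "i1 \<cdot> u = g" and "i2 \<cdot> u = h"
  shows "copairing3 X P i0 i1 i2 f g h = u"
proof -
  have "Cod X f = C" using f by (simp add: hom_def)
  then show ?thesis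
    unfolding copairing3_def using the1_equality[OF cotuple_unique] assms by simp
qed

lemma copairing3_eq_join:
  "copairing3 X P i0 i1 i2 f g h = join X P C {c1 \<cdot> p0 \<cdot> f, c0 \<cdot> p1 \<cdot> g, w \<cdot> h}"
proof -
  obtain j where j: "is_join X P C {c1 \<cdot> p0 \<cdot> f, c0 \<cdot> p1 \<cdot> g, w \<cdot> h} j"
    using join_ex[OF P hom_Obj(2)[OF f] branches_compatible] by blast
  show ?thesis
    using copairing3_eqI[OF is_join_hom(1)[OF j] join_is_cotuple[OF j]] join_eq[OF j] by simp
qed

end

lemma product_is_restriction_coproduct3: "is_restriction_coproduct3 X A B R P i0 i1 i2"
  using P i0(1) i1(1) i2(1) cotuple_unique total_injections
  by (simp add: is_restriction_coproduct3_def is_coproduct3_def)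

end

theorem proposition5p6:
  fixes X :: "('o, 'a) rcat" (structure)
    and A B P R :: 'o
    and p0 p1 \<pi>0 \<pi>1 \<iota>0 \<iota>1 \<iota>2 :: 'a
  assumes "classical_restriction_category X"
    and "has_binary_products X"
    and "has_binary_restriction_products X"
    and "A \<in> Obj X" and "B \<in> Obj X"
    and "is_product X A B P p0 p1"
    and "is_restriction_product X A B R \<pi>0 \<pi>1"
    and "\<iota>0 = pairing X P p0 p1 (Id X A) (zero X A B)"
    and "\<iota>1 = pairing X P p0 p1 (zero X B A) (Id X B)"
    and "\<iota>2 = pairing X P p0 p1 \<pi>0 \<pi>1"
  shows "is_restriction_coproduct3 X A B R P \<iota>0 \<iota>1 \<iota>2
    \<and> (\<forall>C\<in>Obj X. \<forall>f\<in>hom X A C. \<forall>g\<in>hom X B C. \<forall>h\<in>hom X R C.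
         compatible_family X P C
           {idem_compl X (Rst X p1) \<cdot> p0 \<cdot> f,
            idem_compl X (Rst X p0) \<cdot> p1 \<cdot> g,
            restriction_pairing X R \<pi>0 \<pi>1 p0 p1 \<cdot> h} \<and>
         copairing3 X P \<iota>0 \<iota>1 \<iota>2 f g h =
         join X P C
           {idem_compl X (Rst X p1) \<cdot> p0 \<cdot> f,
            idem_compl X (Rst X p0) \<cdot> p1 \<cdot> g,
            restriction_pairing X R \<pi>0 \<pi>1 p0 p1 \<cdot> h})
    \<and> p0 = copairing3 X P \<iota>0 \<iota>1 \<iota>2 (Id X A) (zero X B A) \<pi>0
    \<and> p1 = copairing3 X P \<iota>0 \<iota>1 \<iota>2 (zero X A B) (Id X B) \<pi>1"
proof -
  interpret product_and_restriction_product X A B P R p0 p1 \<pi>0 \<pi>1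
    using assms by (simp add: product_and_restriction_product_def
        product_and_restriction_product_axioms_def)
  have "copairing3 X P \<iota>0 \<iota>1 \<iota>2 (Id X A) (zero X B A) \<pi>0 = p0"
    unfolding assms(8-10)
    by (rule copairing3_eqI[OF Id_hom[OF A] zero_hom[OF B A] pi0 p0 i0(2) i1(2) i2(2)])
  moreover have "copairing3 X P \<iota>0 \<iota>1 \<iota>2 (zero X A B) (Id X B) \<pi>1 = p1"
    unfolding assms(8-10)
    by (rule copairing3_eqI[OF zero_hom[OF A B] Id_hom[OF B] pi1 p1 i0(3) i1(3) i2(3)])
  ultimately show ?thesis
    unfolding assms(8-10)
    using product_is_restriction_coproduct3 branches_compatible copairing3_eq_join by simp
qed

end
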